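(* Let $G := F \wr \mathbb{Z}$ be the restricted wreath product, where $F$ is a non-trivial finite group. Then there is a finite generating set $S$ of $G$ such that $\mathrm{dc}_S(G) = 0$.
   Context: Restricted wreath product: for groups $K$ and $H$, $K \wr H$ is the semidirect product $B \rtimes H$, where the base $B$ is the group (under pointwise multiplication) of all functions $f : H \to K$ with $f(h) \neq 1$ for only finitely many $h \in H$, and the head $H$ acts on $B$ by $(k^{-1} f k)(h) := f(hk^{-1})$ for $h,k \in H$, $f\in B$. Word length and balls: if $G$ is a group with finite generating set $S$, then $|g|_S$ is the least length of a word in $S \cup S^{-1}$ representing $g \in G$, and $\mathbb{B}_S(n) = \{g \in G : |g|_S \leqslant n\}$ for $n \in \mathbb{N}$ (the ball of radius $n$ in the Cayley graph). Degree of commutativity: for a group $G$ with finite generating set $S$, $$\mathrm{dc}_S(G) := \limsup_{n \to \infty} \frac{|\{(a,b) \in \mathbb{B}_S(n)^2 : ab = ba\}|}{|\mathbb{B}_S(n)|^2}.$$ *)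

theory Defs
  imports "HOL-Algebra.Product_Groups" "HOL-Library.Extended_Real"
begin

text \<open>The pair \<open>(n, h)\<close> stands for the product \<open>n h\<close>, and \<open>\<phi> h\<close> is the automorphism
  \<open>n \<mapsto> h n h\<^sup>-\<^sup>1\<close> of the normal factor, so \<open>(n h) (n' h') = (n \<cdot> \<phi> h n') (h h')\<close>.\<close>

definition semidirect_product ::
  "('a, 'c) monoid_scheme \<Rightarrow> ('b, 'd) monoid_scheme \<Rightarrow> ('b \<Rightarrow> 'a \<Rightarrow> 'a) \<Rightarrow> ('a \<times> 'b) monoid" where
  "semidirect_product N H \<phi> =
     \<lparr>carrier = carrier N \<times> carrier H,
      monoid.mult = (\<lambda>(n, h) (n', h'). (n \<otimes>\<^bsub>N\<^esub> \<phi> h n', h \<otimes>\<^bsub>H\<^esub> h')),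
      one = (\<one>\<^bsub>N\<^esub>, \<one>\<^bsub>H\<^esub>)\<rparr>"

text \<open>The right action \<open>(k\<^sup>-\<^sup>1 f k)(h) = f (h k\<^sup>-\<^sup>1)\<close> of the head on the base. Functions are
  restricted to the carrier because \<^const>\<open>sum_group\<close> consists of extensional functions.\<close>

definition head_conj :: "('h, 'd) monoid_scheme \<Rightarrow> 'h \<Rightarrow> ('h \<Rightarrow> 'k) \<Rightarrow> 'h \<Rightarrow> 'k" where
  "head_conj H k f = (\<lambda>h\<in>carrier H. f (h \<otimes>\<^bsub>H\<^esub> inv\<^bsub>H\<^esub> k))"

text \<open>The base \<open>sum_group (carrier H) (\<lambda>_. K)\<close> is the group of finitely supported functions from
  \<open>H\<close> to \<open>K\<close>. As \<^const>\<open>semidirect_product\<close> takes \<open>n \<mapsto> k n k\<^sup>-\<^sup>1\<close>, the action is inverted.\<close>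

definition wreath_product ::
  "('k, 'c) monoid_scheme \<Rightarrow> ('h, 'd) monoid_scheme \<Rightarrow> (('h \<Rightarrow> 'k) \<times> 'h) monoid" where
  "wreath_product K H =
     semidirect_product (sum_group (carrier H) (\<lambda>_. K)) H (\<lambda>k. head_conj H (inv\<^bsub>H\<^esub> k))"

definition word_length :: "('a, 'b) monoid_scheme \<Rightarrow> 'a set \<Rightarrow> 'a \<Rightarrow> nat" where
  "word_length G S g =
     (LEAST n. \<exists>w. length w = n \<and> set w \<subseteq> S \<union> m_inv G ` S \<and> foldr (mult G) w \<one>\<^bsub>G\<^esub> = g)"

definition word_ball :: "('a, 'b) monoid_scheme \<Rightarrow> 'a set \<Rightarrow> nat \<Rightarrow> 'a set" where
  "word_ball G S n = {g \<in> carrier G. word_length G S g \<le> n}"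

text \<open>Meaningful when \<open>S\<close> is a finite generating set of \<open>G\<close>: otherwise \<^const>\<open>word_length\<close> may be
  a \<open>LEAST\<close> over an empty set, or the balls may be infinite and have \<^const>\<open>card\<close> zero.\<close>

definition degree_of_commutativity :: "('a, 'b) monoid_scheme \<Rightarrow> 'a set \<Rightarrow> ereal" where
  "degree_of_commutativity G S =
     limsup (\<lambda>n. ereal (
       real (card {(a, b) \<in> word_ball G S n \<times> word_ball G S n. a \<otimes>\<^bsub>G\<^esub> b = b \<otimes>\<^bsub>G\<^esub> a})
         / (real (card (word_ball G S n)))\<^sup>2))"

lemma group_semidirect_product:
  assumes "group N" "group H"
    and hom: "\<And>h. h \<in> carrier H \<Longrightarrow> \<phi> h \<in> hom N N"
    and one: "\<And>n. n \<in> carrier N \<Longrightarrow> \<phi> \<one>\<^bsub>H\<^esub> n = n"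
    and mult: "\<And>h h' n. h \<in> carrier H \<Longrightarrow> h' \<in> carrier H \<Longrightarrow> n \<in> carrier N \<Longrightarrow>
      \<phi> (h \<otimes>\<^bsub>H\<^esub> h') n = \<phi> h (\<phi> h' n)"
  shows "group (semidirect_product N H \<phi>)"
proof -
  interpret N: group N by fact
  interpret H: group H by fact
  have cl: "\<phi> h n \<in> carrier N" if "h \<in> carrier H" "n \<in> carrier N" for h n
    using hom[OF that(1)] that(2) by (auto simp: hom_def)
  have hm: "\<phi> h (n \<otimes>\<^bsub>N\<^esub> n') = \<phi> h n \<otimes>\<^bsub>N\<^esub> \<phi> h n'"
    if "h \<in> carrier H" "n \<in> carrier N" "n' \<in> carrier N" for h n n'
    using hom[OF that(1)] that(2,3) by (auto simp: hom_def)
  show ?thesis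
  proof (rule groupI)
    fix x assume "x \<in> carrier (semidirect_product N H \<phi>)"
    then obtain n h where x: "x = (n, h)" "n \<in> carrier N" "h \<in> carrier H"
      by (auto simp: semidirect_product_def)
    let ?y = "(\<phi> (inv\<^bsub>H\<^esub> h) (inv\<^bsub>N\<^esub> n), inv\<^bsub>H\<^esub> h)"
    have "\<phi> (inv\<^bsub>H\<^esub> h) (inv\<^bsub>N\<^esub> n) \<otimes>\<^bsub>N\<^esub> \<phi> (inv\<^bsub>H\<^esub> h) n = \<phi> (inv\<^bsub>H\<^esub> h) \<one>\<^bsub>N\<^esub>"
      using x by (simp flip: hm)
    also have "\<dots> = \<one>\<^bsub>N\<^esub>"
      using hom_one[OF hom \<open>group N\<close> \<open>group N\<close>] x by simp
    finally show "\<exists>y\<in>carrier (semidirect_product N H \<phi>).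
        y \<otimes>\<^bsub>semidirect_product N H \<phi>\<^esub> x = \<one>\<^bsub>semidirect_product N H \<phi>\<^esub>"
      using x by (intro bexI[of _ ?y]) (auto simp: semidirect_product_def cl)
  qed (auto simp: semidirect_product_def cl hm one mult N.m_assoc H.m_assoc)
qed

lemma wreath_product_sel:
  assumes "group K"
  shows "carrier (wreath_product K H) =
      {f \<in> carrier H \<rightarrow>\<^sub>E carrier K. finite {h \<in> carrier H. f h \<noteq> \<one>\<^bsub>K\<^esub>}} \<times> carrier H"
    and "\<one>\<^bsub>wreath_product K H\<^esub> = ((\<lambda>h\<in>carrier H. \<one>\<^bsub>K\<^esub>), \<one>\<^bsub>H\<^esub>)"
  using assms by (auto simp: wreath_product_def semidirect_product_def carrier_sum_group)

lemma wreath_product_mult: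
  assumes "group H" "k \<in> carrier H"
  shows "(f, k) \<otimes>\<^bsub>wreath_product K H\<^esub> (f', k') =
      ((\<lambda>h\<in>carrier H. f h \<otimes>\<^bsub>K\<^esub> f' (h \<otimes>\<^bsub>H\<^esub> k)), k \<otimes>\<^bsub>H\<^esub> k')"
  using assms
  by (auto simp: wreath_product_def semidirect_product_def head_conj_def group.inv_inv
      intro!: restrict_ext)

lemma group_wreath_product:
  assumes "group K" "group H"
  shows "group (wreath_product K H)"
proof -
  interpret K: group K by fact
  interpret H: group H by fact
  let ?B = "sum_group (carrier H) (\<lambda>_. K)"
  have fin: "finite {h \<in> carrier H. f (h \<otimes>\<^bsub>H\<^esub> k) \<noteq> \<one>\<^bsub>K\<^esub>}"
    if "finite {h \<in> carrier H. f h \<noteq> \<one>\<^bsub>K\<^esub>}" "k \<in> carrier H" for f :: "'c \<Rightarrow> 'a" and k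
  proof (rule finite_subset)
    show "{h \<in> carrier H. f (h \<otimes>\<^bsub>H\<^esub> k) \<noteq> \<one>\<^bsub>K\<^esub>}
        \<subseteq> (\<lambda>h. h \<otimes>\<^bsub>H\<^esub> inv\<^bsub>H\<^esub> k) ` {h \<in> carrier H. f h \<noteq> \<one>\<^bsub>K\<^esub>}"
    proof
      fix h assume h: "h \<in> {h \<in> carrier H. f (h \<otimes>\<^bsub>H\<^esub> k) \<noteq> \<one>\<^bsub>K\<^esub>}"
      then show "h \<in> (\<lambda>h. h \<otimes>\<^bsub>H\<^esub> inv\<^bsub>H\<^esub> k) ` {h \<in> carrier H. f h \<noteq> \<one>\<^bsub>K\<^esub>}"
        using that(2) by (intro image_eqI[of _ _ "h \<otimes>\<^bsub>H\<^esub> k"]) (auto simp: H.m_assoc)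
    qed
  qed (use that in auto)
  have B: "carrier ?B = {f \<in> carrier H \<rightarrow>\<^sub>E carrier K. finite {h \<in> carrier H. f h \<noteq> \<one>\<^bsub>K\<^esub>}}"
    by (simp add: carrier_sum_group)
  have hc: "head_conj H (inv\<^bsub>H\<^esub> k) f = (\<lambda>h\<in>carrier H. f (h \<otimes>\<^bsub>H\<^esub> k))"
    if "k \<in> carrier H" for f :: "'c \<Rightarrow> 'a" and k
    using that by (simp add: head_conj_def)
  show ?thesis
    unfolding wreath_product_def
  proof (rule group_semidirect_product)
    show "group ?B" by simp
    show "head_conj H (inv\<^bsub>H\<^esub> k) \<in> hom ?B ?B" if k: "k \<in> carrier H" for k
    proof (rule homI)
      show "head_conj H (inv\<^bsub>H\<^esub> k) f \<in> carrier ?B" if "f \<in> carrier ?B" for f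
        using that k fin[of f k] by (auto simp: B hc cong: conj_cong)
    qed (use k in \<open>auto simp: hc intro!: restrict_ext\<close>)
    show "head_conj H (inv\<^bsub>H\<^esub> \<one>\<^bsub>H\<^esub>) f = f" if "f \<in> carrier ?B" for f
    proof -
      have "(\<lambda>h\<in>carrier H. f (h \<otimes>\<^bsub>H\<^esub> \<one>\<^bsub>H\<^esub>)) = restrict f (carrier H)"
        by (rule restrict_ext) simp
      also have "\<dots> = f"
        using that by (auto simp: B PiE_def extensional_restrict)
      finally show ?thesis by (simp only: hc H.one_closed)
    qed
    show "head_conj H (inv\<^bsub>H\<^esub> (k \<otimes>\<^bsub>H\<^esub> k')) f = head_conj H (inv\<^bsub>H\<^esub> k) (head_conj H (inv\<^bsub>H\<^esub> k') f)"
      if "k \<in> carrier H" "k' \<in> carrier H" for k k' and f :: "'c \<Rightarrow> 'a"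
      using that by (auto simp: hc H.m_assoc intro!: restrict_ext)
  qed (rule \<open>group H\<close>)
qed

text \<open>Conjugation by the head inside the wreath product is \<^const>\<open>head_conj\<close>.\<close>

lemma wreath_product_conj:
  assumes "group K" "group H" "k \<in> carrier H" "f \<in> carrier (sum_group (carrier H) (\<lambda>_. K))"
  defines "W \<equiv> wreath_product K H"
  defines "\<kappa> \<equiv> ((\<lambda>h\<in>carrier H. \<one>\<^bsub>K\<^esub>), k)"
  shows "inv\<^bsub>W\<^esub> \<kappa> \<otimes>\<^bsub>W\<^esub> (f, \<one>\<^bsub>H\<^esub>) \<otimes>\<^bsub>W\<^esub> \<kappa> = (head_conj H k f, \<one>\<^bsub>H\<^esub>)"
proof -
  interpret K: group K by fact
  interpret H: group H by fact
  interpret W: group W unfolding W_def by (rule group_wreath_product) fact+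
  let ?\<kappa>' = "((\<lambda>h\<in>carrier H. \<one>\<^bsub>K\<^esub>), inv\<^bsub>H\<^esub> k)"
  have f: "f h \<in> carrier K" if "h \<in> carrier H" for h
    using assms(4) that by (auto simp: carrier_sum_group)
  have "?\<kappa>' \<otimes>\<^bsub>W\<^esub> \<kappa> = \<one>\<^bsub>W\<^esub>"
    using assms(3) unfolding W_def \<kappa>_def
    by (auto simp: wreath_product_mult wreath_product_sel intro!: restrict_ext)
  moreover have "?\<kappa>' \<in> carrier W" "\<kappa> \<in> carrier W"
    using assms(3) unfolding W_def \<kappa>_def by (auto simp: wreath_product_sel)
  ultimately have "inv\<^bsub>W\<^esub> \<kappa> = ?\<kappa>'"
    by (metis W.inv_equality)
  then show ?thesis
    using assms(3) f unfolding W_def \<kappa>_def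
    by (auto simp: wreath_product_mult head_conj_def intro!: restrict_ext)
qed

end

theory Submission
  imports Defs "HOL-Real_Asymp.Real_Asymp"
begin

text \<open>The generating set consists of the elements \<open>(\<delta>\<^sub>0 x, 1)\<close> with \<open>x \<in> F\<close>. Placing the lamp \<open>h\<close> on
  the edge between the integers \<open>h - 1\<close> and \<open>h\<close>, multiplying by a generator or its inverse crosses
  an edge and changes the lamp of that edge arbitrarily. Hence an element \<open>(f, k)\<close> has
  length at most \<open>n\<close> only if its lamps lie in an interval that contains \<open>0\<close> and \<open>-k\<close> and has
  length at most \<open>(n + \<bar>k\<bar>) / 2\<close>. With \<open>q = |F|\<close>, the ball of radius \<open>n\<close> thus has at least
  \<open>q ^ n\<close> elements, of which at most \<open>(n + 1) q ^ (n div 2)\<close> lie in the base. The centraliser of an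
  element outside the base meets every coset of the base in at most one element, because a
  finite subset of the integers invariant under a non-trivial translation is empty; so it has at
  most \<open>2 n + 1\<close> elements in the ball.\<close>

section \<open>Words and balls\<close>

context group
begin

lemma foldr_mult_closed:
  "set w \<subseteq> carrier G \<Longrightarrow> foldr (mult G) w \<one> \<in> carrier G"
  by (induction w) auto

lemma foldr_mult_append:
  assumes "set v \<subseteq> carrier G" "set w \<subseteq> carrier G"
  shows "foldr (mult G) (v @ w) \<one> = foldr (mult G) v \<one> \<otimes> foldr (mult G) w \<one>"
  using assms(1) by (induction v) (auto simp: m_assoc foldr_mult_closed assms(2))

lemma letters_closed: "S \<subseteq> carrier G \<Longrightarrow> S \<union> m_inv G ` S \<subseteq> carrier G"
  by auto

lemma generate_word:
  assumes S: "S \<subseteq> carrier G" and "g \<in> generate G S"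
  shows "\<exists>w. set w \<subseteq> S \<union> m_inv G ` S \<and> foldr (mult G) w \<one> = g"
  using assms(2)
proof (induction rule: generate.induct)
  case one
  show ?case by (intro exI[of _ "[]"]) auto
next
  case (incl h)
  then show ?case using S by (intro exI[of _ "[h]"]) auto
next
  case (inv h)
  then show ?case using S by (intro exI[of _ "[inv h]"]) auto
next
  case (eng g h)
  then obtain v w where "set v \<subseteq> S \<union> m_inv G ` S" "foldr (mult G) v \<one> = g"
    "set w \<subseteq> S \<union> m_inv G ` S" "foldr (mult G) w \<one> = h"
    by blast
  moreover from this have "set v \<subseteq> carrier G" "set w \<subseteq> carrier G"
    using letters_closed[OF S] by blast+
  ultimately show ?case
    by (intro exI[of _ "v @ w"]) (simp add: foldr_mult_append del: foldr_append)
qed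

text \<open>Since \<open>S\<close> generates \<open>G\<close>, the \<open>LEAST\<close> in
  \<open>word_length\<close> ranges over a non-empty set and is attained by a word. The ball becomes
  the image of a set of words, which gives finiteness and allows induction on words.\<close>

lemma word_ball_eq:
  assumes S: "S \<subseteq> carrier G" and gen: "generate G S = carrier G"
  shows "word_ball G S n =
    (\<lambda>w. foldr (mult G) w \<one>) ` {w. set w \<subseteq> S \<union> m_inv G ` S \<and> length w \<le> n}" (is "_ = ?B")
proof (intro subset_antisym subsetI)
  fix g assume g: "g \<in> word_ball G S n"
  let ?P = "\<lambda>m. \<exists>w. length w = m \<and> set w \<subseteq> S \<union> m_inv G ` S \<and> foldr (mult G) w \<one> = g"
  have "\<exists>m. ?P m"
    using generate_word[OF S, of g] g gen by (auto simp: word_ball_def)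
  then have "?P (word_length G S g)"
    unfolding word_length_def by (rule LeastI_ex)
  then show "g \<in> ?B"
    using g by (auto simp: word_ball_def)
next
  fix g assume "g \<in> ?B"
  then obtain w where w: "set w \<subseteq> S \<union> m_inv G ` S" "length w \<le> n" "foldr (mult G) w \<one> = g"
    by blast
  have "word_length G S g \<le> length w"
    unfolding word_length_def by (rule Least_le) (use w in blast)
  moreover have "g \<in> carrier G"
    using foldr_mult_closed[of w] w letters_closed[OF S] by blast
  ultimately show "g \<in> word_ball G S n"
    using w(2) by (simp add: word_ball_def)
qed

lemma finite_word_ball:
  assumes "S \<subseteq> carrier G" "generate G S = carrier G" "finite S"
  shows "finite (word_ball G S n)"
  unfolding word_ball_eq[OF assms(1,2)] using assms(3) by (simp add: finite_lists_length_le)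

end

section \<open>Finitely supported functions\<close>

text \<open>Total functions with default value \<open>d\<close> correspond to \<open>PiE\<close>
  functions by restriction to \<open>A\<close>; the inverse map extends by \<open>d\<close>.\<close>

lemma card_supported_functions:
  fixes A :: "'a set" and C :: "'b set"
  assumes "finite A" "d \<in> C"
  shows "card {f. range f \<subseteq> C \<and> (\<forall>h. h \<notin> A \<longrightarrow> f h = d)} = card C ^ card A"
proof -
  let ?X = "{f. range f \<subseteq> C \<and> (\<forall>h. h \<notin> A \<longrightarrow> f h = d)}"
  have "bij_betw (\<lambda>f. restrict f A) ?X (A \<rightarrow>\<^sub>E C)"
  proof (rule bij_betwI[where g = "\<lambda>f h. if h \<in> A then f h else d"])
    show "(\<lambda>f. restrict f A) \<in> ?X \<rightarrow> (A \<rightarrow>\<^sub>E C)"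
      by auto
    show "(\<lambda>f h. if h \<in> A then f h else d) \<in> (A \<rightarrow>\<^sub>E C) \<rightarrow> ?X"
      using assms(2) by auto
  qed (auto simp: fun_eq_iff PiE_def extensional_def)
  then show ?thesis
    using assms(1) by (simp add: bij_betw_same_card card_funcsetE)
qed

lemma finite_supported_functions:
  assumes "finite A" "finite C"
  shows "finite {f. range f \<subseteq> C \<and> (\<forall>h. h \<notin> A \<longrightarrow> f h = d)}"
  by (rule finite_subset[OF _ finite_set_of_finite_funs[OF assms, of d]]) auto

text \<open>A single point would have an infinite orbit under the translation. The lemma is applied
  to the set where two functions differ.\<close>

lemma translation_invariant_finite_empty:
  fixes D :: "int set"
  assumes "finite D" "k \<noteq> 0" and inv: "\<And>h. h \<in> D \<Longrightarrow> h + k \<in> D"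
  shows "D = {}"
proof (rule ccontr)
  assume "D \<noteq> {}"
  then obtain h where h: "h \<in> D" by blast
  have "h + int i * k \<in> D" for i
  proof (induction i)
    case (Suc i)
    then show ?case using inv[OF Suc] by (simp add: algebra_simps)
  qed (use h in simp)
  then have "range (\<lambda>i. h + int i * k) \<subseteq> D" by blast
  moreover have "inj (\<lambda>i. h + int i * k)"
    using \<open>k \<noteq> 0\<close> by (auto simp: inj_on_def)
  ultimately show False
    using \<open>finite D\<close> finite_subset range_inj_infinite by blast
qed

section \<open>The lamplighter group\<close>

locale lamplighter = F: group F for F :: "('a, 'b) monoid_scheme" +
  fixes G
  defines "G \<equiv> wreath_product F integer_group"
begin

section \<open>Coordinates and generators\<close>

definition lamp :: "int \<Rightarrow> 'a \<Rightarrow> int \<Rightarrow> 'a" where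
  "lamp j x = (\<lambda>h. if h = j then x else \<one>\<^bsub>F\<^esub>)"

text \<open>The choice \<open>x = \<one>\<close> makes the pure shift by 1 a generator.\<close>

definition steps :: "((int \<Rightarrow> 'a) \<times> int) set" where
  "steps = (\<lambda>x. (lamp 0 x, 1)) ` carrier F"

lemma group_G: "group G"
  unfolding G_def by (rule group_wreath_product) (simp_all add: F.group_axioms)

sublocale G: group G by (rule group_G)

text \<open>The head is all of \<open>int\<close>, so extensionality is vacuous and base elements
  are plain functions.\<close>

lemma carrier_G:
  "carrier G = {f. range f \<subseteq> carrier F \<and> finite {h. f h \<noteq> \<one>\<^bsub>F\<^esub>}} \<times> UNIV"
  unfolding G_def by (auto simp: wreath_product_sel[OF F.group_axioms])

lemma one_G: "\<one>\<^bsub>G\<^esub> = (\<lambda>h. \<one>\<^bsub>F\<^esub>, 0)"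
  unfolding G_def by (auto simp: wreath_product_sel[OF F.group_axioms])

lemma mult_G: "(f, k) \<otimes>\<^bsub>G\<^esub> (f', k') = (\<lambda>h. f h \<otimes>\<^bsub>F\<^esub> f' (h + k), k + k')"
  unfolding G_def by (auto simp: wreath_product_mult)

lemma lamp_in_carrier: "x \<in> carrier F \<Longrightarrow> (lamp j x, k) \<in> carrier G"
  by (auto simp: carrier_G lamp_def)

lemma steps_subset: "steps \<subseteq> carrier G"
  by (auto simp: steps_def lamp_in_carrier)

text \<open>The inverse changes lamp 1 rather than lamp 0: a move from 0 to 1 crosses the edge
  numbered 1.\<close>

lemma inv_step: "x \<in> carrier F \<Longrightarrow> inv\<^bsub>G\<^esub> (lamp 0 x, 1) = (lamp 1 (inv\<^bsub>F\<^esub> x), -1)"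
  by (rule G.inv_equality) (auto simp: mult_G one_G lamp_def fun_eq_iff carrier_G)

lemma inv_shift: "inv\<^bsub>G\<^esub> (\<lambda>h. \<one>\<^bsub>F\<^esub>, k) = (\<lambda>h. \<one>\<^bsub>F\<^esub>, -k)"
  by (rule G.inv_equality) (auto simp: mult_G one_G carrier_G)

lemma generate_steps: "generate G steps = carrier G"
proof
  show "generate G steps \<subseteq> carrier G"
    by (rule G.generate_incl[OF steps_subset])
next
  let ?H = "generate G steps"
  have one_eq: "lamp j \<one>\<^bsub>F\<^esub> = (\<lambda>h. \<one>\<^bsub>F\<^esub>)" for j
    by (auto simp: lamp_def)
  have mult: "a \<otimes>\<^bsub>G\<^esub> b \<in> ?H" if "a \<in> ?H" "b \<in> ?H" for a b
    using that by (rule generate.eng)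
  have step: "(lamp 0 x, 1) \<in> ?H" if "x \<in> carrier F" for x
    using that by (intro generate.incl) (auto simp: steps_def)
  have shift_nat: "(\<lambda>h. \<one>\<^bsub>F\<^esub>, int n) \<in> ?H" for n
  proof (induction n)
    case 0
    show ?case using generate.one[of G steps] by (simp add: one_G)
  next
    case (Suc n)
    show ?case
      using mult[OF Suc step[OF F.one_closed]] by (simp add: mult_G one_eq add.commute)
  qed
  have shift: "(\<lambda>h. \<one>\<^bsub>F\<^esub>, k) \<in> ?H" for k
  proof (cases "k \<ge> 0")
    case True
    then show ?thesis using shift_nat[of "nat k"] by simp
  next
    case False
    then show ?thesis
      using G.generate_m_inv_closed[OF steps_subset shift_nat[of "nat (-k)"]]
      by (simp add: inv_shift)
  qed
  have lamp: "(lamp j x, 0) \<in> ?H" if x: "x \<in> carrier F" for j x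
  proof -
    \<comment> \<open>The first shift places the lamp at \<open>j\<close>; the last one is by
      \<open>j - 1\<close> because the step itself already moves the head by 1.\<close>
    have "(lamp j x, 0) = ((\<lambda>h. \<one>\<^bsub>F\<^esub>, -j) \<otimes>\<^bsub>G\<^esub> (lamp 0 x, 1)) \<otimes>\<^bsub>G\<^esub> (\<lambda>h. \<one>\<^bsub>F\<^esub>, j - 1)"
      using x by (auto simp: mult_G lamp_def fun_eq_iff)
    also have "\<dots> \<in> ?H"
      by (intro mult shift step x)
    finally show ?thesis .
  qed
  \<comment> \<open>Here \<open>A\<close> only bounds the support, so the induction can switch off
    one lamp at a time.\<close>
  have base: "(f, 0) \<in> ?H"
    if "finite A" "\<And>h. f h \<in> carrier F" "\<And>h. h \<notin> A \<Longrightarrow> f h = \<one>\<^bsub>F\<^esub>" for A f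
    using that
  proof (induction A arbitrary: f rule: finite_induct)
    case empty
    then have "f = (\<lambda>h. \<one>\<^bsub>F\<^esub>)" by auto
    then show ?case using shift by simp
  next
    case (insert j A)
    have "(f, 0) = (f(j := \<one>\<^bsub>F\<^esub>), 0) \<otimes>\<^bsub>G\<^esub> (lamp j (f j), 0)"
      using insert.prems(1) by (auto simp: mult_G lamp_def fun_eq_iff)
    also have "\<dots> \<in> ?H"
      using insert.prems by (intro mult insert.IH lamp) auto
    finally show ?case .
  qed
  show "carrier G \<subseteq> ?H"
  proof
    fix g assume "g \<in> carrier G"
    then obtain f k where g: "g = (f, k)" "range f \<subseteq> carrier F" "finite {h. f h \<noteq> \<one>\<^bsub>F\<^esub>}"
      by (auto simp: carrier_G)
    have "(f, 0) \<in> ?H"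
      using g(2) by (intro base[OF g(3)]) auto
    moreover have "g = (f, 0) \<otimes>\<^bsub>G\<^esub> (\<lambda>h. \<one>\<^bsub>F\<^esub>, k)"
      using g by (auto simp: mult_G fun_eq_iff image_subset_iff)
    ultimately show "g \<in> ?H"
      using mult shift by simp
  qed
qed

section \<open>Words and the support of their values\<close>

lemmas ball_eq = G.word_ball_eq[OF steps_subset generate_steps]

text \<open>Walking \<open>n\<close> steps in one direction crosses \<open>n\<close> different
  edges, each once, so their lamps can be set independently. This provides the lower bound for the
  ball.\<close>

lemma foldr_steps:
  assumes "\<And>h. f h \<in> carrier F" "\<And>h. h \<notin> {- int n<..0} \<Longrightarrow> f h = \<one>\<^bsub>F\<^esub>"
  shows "\<exists>w. set w \<subseteq> steps \<and> length w = n \<and> foldr (mult G) w \<one>\<^bsub>G\<^esub> = (f, int n)"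
  using assms
proof (induction n arbitrary: f)
  case 0
  then have "f = (\<lambda>h. \<one>\<^bsub>F\<^esub>)" by auto
  then show ?case by (auto simp: one_G)
next
  case (Suc n)
  \<comment> \<open>The first letter sets lamp 0 and shifts the rest, so the remaining word must
    produce \<open>f\<close> moved by one place, with the former lamp 0 switched off.\<close>
  let ?f' = "\<lambda>h. if h = 1 then \<one>\<^bsub>F\<^esub> else f (h - 1)"
  have "\<exists>w. set w \<subseteq> steps \<and> length w = n \<and> foldr (mult G) w \<one>\<^bsub>G\<^esub> = (?f', int n)"
    using Suc.prems by (intro Suc.IH) auto
  then obtain w where w: "set w \<subseteq> steps" "length w = n" "foldr (mult G) w \<one>\<^bsub>G\<^esub> = (?f', int n)"
    by blast
  show ?case
    using w Suc.prems(1)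
    by (intro exI[of _ "(lamp 0 (f 0), 1) # w"])
      (auto simp: mult_G lamp_def fun_eq_iff steps_def)
qed

text \<open>The walk of the lamplighter starts at \<open>0\<close>, ends at \<open>-k\<close> and stays in \<open>[l, r]\<close>.\<close>

lemma walk_range:
  assumes "set w \<subseteq> steps \<union> m_inv G ` steps" "foldr (mult G) w \<one>\<^bsub>G\<^esub> = (f, k)"
  shows "\<exists>l r. l \<le> 0 \<and> 0 \<le> r \<and> l \<le> -k \<and> -k \<le> r \<and> 2 * (r - l) - \<bar>k\<bar> \<le> int (length w) \<and>
    (\<forall>h. h \<notin> {l<..r} \<longrightarrow> f h = \<one>\<^bsub>F\<^esub>)"
  using assms
proof (induction w arbitrary: f k)
  case Nil
  then show ?case by (intro exI[of _ 0]) (auto simp: one_G)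
next
  case (Cons s w)
  obtain f' k' where f': "foldr (mult G) w \<one>\<^bsub>G\<^esub> = (f', k')" by fastforce
  with Cons obtain l r where lr: "l \<le> 0" "0 \<le> r" "l \<le> -k'" "-k' \<le> r"
    "2 * (r - l) - \<bar>k'\<bar> \<le> int (length w)" and supp: "\<And>h. h \<notin> {l<..r} \<Longrightarrow> f' h = \<one>\<^bsub>F\<^esub>"
    by fastforce
  have s: "s \<otimes>\<^bsub>G\<^esub> (f', k') = (f, k)"
    using Cons.prems(2) f' by simp
  from Cons.prems(1) consider
      (fwd) x where "x \<in> carrier F" "s = (lamp 0 x, 1)"
    | (bwd) x where "x \<in> carrier F" "s = (lamp 1 (inv\<^bsub>F\<^esub> x), -1)"
    by (auto simp: steps_def inv_step)
  then show ?case
  proof cases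
    case fwd
    then have k: "k = k' + 1" and f: "f = (\<lambda>h. lamp 0 x h \<otimes>\<^bsub>F\<^esub> f' (h + 1))"
      using s by (auto simp: mult_G)
    \<comment> \<open>The new first letter moves from 0 to -1, and the old walk follows, translated
      by -1. The maximum keeps the starting point 0 in the interval.\<close>
    have "f h = \<one>\<^bsub>F\<^esub>" if "h \<notin> {l - 1<..max (r - 1) 0}" for h
      using that lr supp[of "h + 1"] by (auto simp: f lamp_def max_def split: if_splits)
    \<comment> \<open>If \<open>r = 0\<close>, the interval grows by 1, but then
      \<open>k' \<ge> 0\<close>, so \<open>\<bar>k\<bar>\<close> grows by 1 too. Otherwise the
      interval keeps its length and \<open>\<bar>k\<bar>\<close> drops by at most 1. Either way the
      left side increases by at most 1.\<close>
    moreover have "2 * (max (r - 1) 0 - (l - 1)) - \<bar>k\<bar> \<le> int (length (s # w))"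
      using lr k by (cases "r = 0") auto
    moreover have "l - 1 \<le> -k" "-k \<le> max (r - 1) 0" "l - 1 \<le> 0" "0 \<le> max (r - 1) 0"
      using lr k by auto
    ultimately show ?thesis by blast
  next
    case bwd
    then have k: "k = k' - 1" and f: "f = (\<lambda>h. lamp 1 (inv\<^bsub>F\<^esub> x) h \<otimes>\<^bsub>F\<^esub> f' (h - 1))"
      using s by (auto simp: mult_G)
    \<comment> \<open>Mirror image of the forward case: the first move goes to 1, and the left end
      is the one that may need extending to 0.\<close>
    have "f h = \<one>\<^bsub>F\<^esub>" if "h \<notin> {min (l + 1) 0<..r + 1}" for h
      using that lr supp[of "h - 1"] by (auto simp: f lamp_def min_def split: if_splits)
    moreover have "2 * (r + 1 - min (l + 1) 0) - \<bar>k\<bar> \<le> int (length (s # w))"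
      using lr k by (cases "l = 0") auto
    moreover have "min (l + 1) 0 \<le> -k" "-k \<le> r + 1" "min (l + 1) 0 \<le> 0" "0 \<le> r + 1"
      using lr k by auto
    ultimately show ?thesis by blast
  qed
qed

lemma ball_range:
  assumes "(f, k) \<in> word_ball G steps n"
  obtains l r where "l \<le> 0" "0 \<le> r" "l \<le> -k" "-k \<le> r" "2 * (r - l) - \<bar>k\<bar> \<le> int n"
    "\<And>h. h \<notin> {l<..r} \<Longrightarrow> f h = \<one>\<^bsub>F\<^esub>"
proof -
  from assms obtain w where w: "set w \<subseteq> steps \<union> m_inv G ` steps" "length w \<le> n"
    "foldr (mult G) w \<one>\<^bsub>G\<^esub> = (f, k)"
    by (auto simp: ball_eq)
  show ?thesis
    using walk_range[OF w(1,3)] w(2) that by (smt (verit, best) of_nat_mono)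
qed

lemma ball_subset: "word_ball G steps n \<subseteq> carrier G"
  by (auto simp: word_ball_def)

lemma commuting_determined:
  assumes a: "(f, k) \<in> carrier G" "k \<noteq> 0"
    and u: "(u, m) \<in> carrier G" "(f, k) \<otimes>\<^bsub>G\<^esub> (u, m) = (u, m) \<otimes>\<^bsub>G\<^esub> (f, k)"
    and v: "(v, m) \<in> carrier G" "(f, k) \<otimes>\<^bsub>G\<^esub> (v, m) = (v, m) \<otimes>\<^bsub>G\<^esub> (f, k)"
  shows "u = v"
proof -
  have cl: "f h \<in> carrier F" "u h \<in> carrier F" "v h \<in> carrier F" for h
    using a u v by (auto simp: carrier_G)
  have eq: "f h \<otimes>\<^bsub>F\<^esub> u (h + k) = u h \<otimes>\<^bsub>F\<^esub> f (h + m)"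
    "f h \<otimes>\<^bsub>F\<^esub> v (h + k) = v h \<otimes>\<^bsub>F\<^esub> f (h + m)" for h
    using u(2) v(2) by (auto simp: mult_G fun_eq_iff)
  \<comment> \<open>If \<open>u\<close> and \<open>v\<close> agree at \<open>h + k\<close>, then
    \<open>eq\<close> and cancellation of \<open>f (h + m)\<close> make them agree at
    \<open>h\<close>. Hence the set of disagreement is invariant under translation by
    \<open>k\<close>.\<close>
  have "{h. u h \<noteq> v h} = {}"
  proof (rule translation_invariant_finite_empty[OF _ \<open>k \<noteq> 0\<close>])
    have "finite ({h. u h \<noteq> \<one>\<^bsub>F\<^esub>} \<union> {h. v h \<noteq> \<one>\<^bsub>F\<^esub>})"
      using u(1) v(1) by (simp add: carrier_G)
    then show "finite {h. u h \<noteq> v h}"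
      by (rule rev_finite_subset) auto
    show "h + k \<in> {h. u h \<noteq> v h}" if "h \<in> {h. u h \<noteq> v h}" for h
      using that eq[of h] cl by (metis (mono_tags, lifting) F.right_cancel mem_Collect_eq)
  qed
  then show ?thesis by auto
qed

lemma card_centraliser_ball:
  assumes "(f, k) \<in> carrier G" "k \<noteq> 0"
  shows "card {b \<in> word_ball G steps n. (f, k) \<otimes>\<^bsub>G\<^esub> b = b \<otimes>\<^bsub>G\<^esub> (f, k)} \<le> 2 * n + 1" (is "card ?C \<le> _")
proof -
  have "inj_on snd ?C"
    using commuting_determined[OF assms] ball_subset by (fastforce simp: inj_on_def)
  \<comment> \<open>The interval contains 0 and the end of the walk, so
    \<open>r - l \<ge> \<bar>k\<bar>\<close> and the length bound yields
    \<open>\<bar>k\<bar> \<le> n\<close>.\<close>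
  moreover have "snd ` ?C \<subseteq> {- int n..int n}"
    by (auto elim!: ball_range)
  ultimately have "card ?C \<le> card {- int n..int n}"
    by (rule card_inj_on_le) simp
  then show ?thesis by simp
qed

section \<open>Counting in the ball\<close>

lemma finite_ball:
  assumes "finite (carrier F)"
  shows "finite (word_ball G steps n)"
  using assms by (intro G.finite_word_ball steps_subset generate_steps) (simp add: steps_def)

lemma card_ball_ge:
  assumes "finite (carrier F)"
  shows "card (carrier F) ^ n \<le> card (word_ball G steps n)"
proof -
  let ?X = "{f. range f \<subseteq> carrier F \<and> (\<forall>h. h \<notin> {- int n<..0} \<longrightarrow> f h = \<one>\<^bsub>F\<^esub>)}"
  have "(\<lambda>f. (f, int n)) ` ?X \<subseteq> word_ball G steps n"
  proof clarify
    fix f assume "range f \<subseteq> carrier F" "\<forall>h. h \<notin> {- int n<..0} \<longrightarrow> f h = \<one>\<^bsub>F\<^esub>"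
    then obtain w where "set w \<subseteq> steps" "length w = n" "foldr (mult G) w \<one>\<^bsub>G\<^esub> = (f, int n)"
      using foldr_steps[of f n] by blast
    then show "(f, int n) \<in> word_ball G steps n"
      unfolding ball_eq by (intro image_eqI[of _ _ w]) auto
  qed
  then have "card ?X \<le> card (word_ball G steps n)"
    by (rule card_inj_on_le[rotated]) (auto simp: inj_on_def finite_ball[OF assms])
  then show ?thesis
    by (subst (asm) card_supported_functions) auto
qed

lemma card_ball_base_le:
  assumes "finite (carrier F)"
  shows "card {a \<in> word_ball G steps n. snd a = 0} \<le> (n + 1) * card (carrier F) ^ (n div 2)"
proof -
  \<comment> \<open>For head component 0 the walk returns to 0, so its interval has length at most
    \<open>n div 2\<close>. Padding it to exactly this length leaves only the left end
    \<open>l\<close> to choose, in at most \<open>n + 1\<close> ways.\<close>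
  let ?X = "\<lambda>l. {f. range f \<subseteq> carrier F \<and> (\<forall>h. h \<notin> {l<..l + int (n div 2)} \<longrightarrow> f h = \<one>\<^bsub>F\<^esub>)}"
  let ?U = "\<Union>l\<in>{- int n..0}. ?X l"
  have "{a \<in> word_ball G steps n. snd a = 0} \<subseteq> (\<lambda>f. (f, 0)) ` ?U"
  proof clarify
    fix f :: "int \<Rightarrow> 'a" and k :: int
    assume a: "(f, k) \<in> word_ball G steps n" "snd (f, k) = 0"
    from a(1) obtain l r where lr: "l \<le> 0" "0 \<le> r" "2 * (r - l) - \<bar>k\<bar> \<le> int n"
      "\<And>h. h \<notin> {l<..r} \<Longrightarrow> f h = \<one>\<^bsub>F\<^esub>"
      using ball_range by metis
    have "range f \<subseteq> carrier F"
      using a(1) ball_subset by (auto simp: carrier_G)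
    moreover have "r \<le> l + int (n div 2)" "- int n \<le> l"
      using lr(1-3) a(2) by (simp_all add: zdiv_int)
    ultimately show "(f, k) \<in> (\<lambda>f. (f, 0)) ` ?U"
      using lr(1,4) a(2) by (intro image_eqI[of _ _ f] UN_I[of l]) auto
  qed
  moreover have fin: "finite ?U"
    using assms by (intro finite_UN_I finite_supported_functions) auto
  ultimately have "card {a \<in> word_ball G steps n. snd a = 0} \<le> card ((\<lambda>f. (f, 0 :: int)) ` ?U)"
    by (intro card_mono) auto
  also have "\<dots> \<le> card ?U"
    by (rule card_image_le[OF fin])
  also have "\<dots> \<le> (\<Sum>l\<in>{- int n..0}. card (?X l))"
    by (rule card_UN_le) simp
  also have "\<dots> = (n + 1) * card (carrier F) ^ (n div 2)"
    by (subst card_supported_functions) (auto simp: nat_add_distrib)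
  finally show ?thesis .
qed

section \<open>Commuting pairs and the limit\<close>

lemma card_commuting_le:
  assumes "finite (carrier F)"
  defines "B \<equiv> word_ball G steps"
  shows "card {(a, b) \<in> B n \<times> B n. a \<otimes>\<^bsub>G\<^esub> b = b \<otimes>\<^bsub>G\<^esub> a}
    \<le> card (B n) * ((n + 1) * card (carrier F) ^ (n div 2) + (2 * n + 1))"
proof -
  let ?B0 = "{a \<in> B n. snd a = 0}"
  let ?C = "\<lambda>a. {b \<in> B n. a \<otimes>\<^bsub>G\<^esub> b = b \<otimes>\<^bsub>G\<^esub> a}"
  have fin: "finite (B n)"
    unfolding B_def by (rule finite_ball[OF assms(1)])
  have "{(a, b) \<in> B n \<times> B n. a \<otimes>\<^bsub>G\<^esub> b = b \<otimes>\<^bsub>G\<^esub> a} \<subseteq> ?B0 \<times> B n \<union> (SIGMA a:B n - ?B0. ?C a)"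
    by auto
  then have "card {(a, b) \<in> B n \<times> B n. a \<otimes>\<^bsub>G\<^esub> b = b \<otimes>\<^bsub>G\<^esub> a}
      \<le> card (?B0 \<times> B n \<union> (SIGMA a:B n - ?B0. ?C a))"
    using fin by (intro card_mono) auto
  also have "\<dots> \<le> card (?B0 \<times> B n) + card (SIGMA a:B n - ?B0. ?C a)"
    by (rule card_Un_le)
  also have "card (?B0 \<times> B n) \<le> card (B n) * ((n + 1) * card (carrier F) ^ (n div 2))"
    using card_ball_base_le[OF assms(1), of n] by (simp add: B_def card_cartesian_product)
  also have "card (SIGMA a:B n - ?B0. ?C a) = (\<Sum>a\<in>B n - ?B0. card (?C a))"
    using fin by simp
  also have "\<dots> \<le> (\<Sum>a\<in>B n - ?B0. 2 * n + 1)"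
  proof (rule sum_mono)
    fix a assume "a \<in> B n - ?B0"
    then show "card (?C a) \<le> 2 * n + 1"
      using card_centraliser_ball[of "fst a" "snd a" n] ball_subset by (auto simp: B_def)
  qed
  also have "\<dots> \<le> card (B n) * (2 * n + 1)"
    unfolding sum_constant of_nat_id
    by (intro mult_le_mono1 card_mono fin) auto
  finally show ?thesis
    by (simp add: distrib_left)
qed

lemma commuting_ratio_le:
  assumes "finite (carrier F)" "carrier F \<noteq> {\<one>\<^bsub>F\<^esub>}"
  defines "B \<equiv> word_ball G steps"
  shows "real (card {(a, b) \<in> B n \<times> B n. a \<otimes>\<^bsub>G\<^esub> b = b \<otimes>\<^bsub>G\<^esub> a}) / (real (card (B n)))\<^sup>2
    \<le> (6 * real (n div 2) + 5) / 2 ^ (n div 2)"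
proof -
  define q where "q = card (carrier F)"
  define m where "m = n div 2"
  have "card {\<one>\<^bsub>F\<^esub>} < q"
    unfolding q_def using assms by (intro psubset_card_mono) auto
  then have q: "2 \<le> q" by simp
  have B: "q ^ n \<le> card (B n)"
    unfolding B_def q_def by (rule card_ball_ge[OF assms(1)])
  then have pos: "0 < card (B n)"
    using q by (metis gr0I le_zero_eq not_numeral_le_zero power_not_zero)
  have q1: "1 \<le> q ^ m"
    using q by simp
  have "(2 * n + 1) * 1 \<le> (2 * n + 1) * q ^ m"
    using q1 by (rule mult_le_mono2)
  then have "card {(a, b) \<in> B n \<times> B n. a \<otimes>\<^bsub>G\<^esub> b = b \<otimes>\<^bsub>G\<^esub> a}
      \<le> card (B n) * ((n + 1) * q ^ m + (2 * n + 1) * q ^ m)"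
    using card_commuting_le[OF assms(1), of n, folded B_def q_def m_def]
    by (elim order_trans) (intro mult_le_mono2 add_left_mono, simp)
  also have "\<dots> = card (B n) * ((3 * n + 2) * q ^ m)"
    by (simp add: algebra_simps)
  \<comment> \<open>Uses \<open>n \<le> 2 * m + 1\<close>, so that the final bound depends on
    \<open>m\<close> alone.\<close>
  also have "\<dots> \<le> card (B n) * ((6 * m + 5) * q ^ m)"
    by (intro mult_le_mono2 mult_le_mono1) (simp add: m_def)
  finally have num: "card {(a, b) \<in> B n \<times> B n. a \<otimes>\<^bsub>G\<^esub> b = b \<otimes>\<^bsub>G\<^esub> a}
    \<le> card (B n) * ((6 * m + 5) * q ^ m)" .
  \<comment> \<open>One factor \<open>q ^ m\<close> of the ball absorbs the numerator's power of
    \<open>q\<close>; the other is weakened to \<open>2 ^ m\<close>, which makes the decay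
    independent of \<open>F\<close>.\<close>
  have "2 ^ m * q ^ m \<le> q ^ m * q ^ m"
    using q by (intro mult_le_mono1 power_mono) auto
  also have "\<dots> \<le> q ^ n"
    using q by (subst power_add[symmetric], intro power_increasing) (auto simp: m_def)
  finally have den: "2 ^ m * q ^ m \<le> card (B n)"
    using B by linarith
  have "card {(a, b) \<in> B n \<times> B n. a \<otimes>\<^bsub>G\<^esub> b = b \<otimes>\<^bsub>G\<^esub> a} * 2 ^ m
    \<le> card (B n) * ((6 * m + 5) * q ^ m) * 2 ^ m"
    using num by (rule mult_le_mono1)
  also have "\<dots> = card (B n) * (6 * m + 5) * (2 ^ m * q ^ m)"
    by (simp add: algebra_simps)
  also have "\<dots> \<le> card (B n) * (6 * m + 5) * card (B n)"
    using den by (rule mult_le_mono2)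
  finally have "card {(a, b) \<in> B n \<times> B n. a \<otimes>\<^bsub>G\<^esub> b = b \<otimes>\<^bsub>G\<^esub> a} * 2 ^ m
    \<le> (6 * m + 5) * (card (B n))\<^sup>2"
    by (simp add: power2_eq_square algebra_simps)
  then have "real (card {(a, b) \<in> B n \<times> B n. a \<otimes>\<^bsub>G\<^esub> b = b \<otimes>\<^bsub>G\<^esub> a}) * 2 ^ m
    \<le> (6 * real m + 5) * (real (card (B n)))\<^sup>2"
    by (simp flip: of_nat_le_iff[where ?'a = real])
  then show ?thesis
    using pos by (simp add: m_def[symmetric] field_simps)
qed

lemma degree_of_commutativity_steps:
  assumes "finite (carrier F)" "carrier F \<noteq> {\<one>\<^bsub>F\<^esub>}"
  shows "degree_of_commutativity G steps = 0"
proof -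
  let ?r = "\<lambda>n. real (card {(a, b) \<in> word_ball G steps n \<times> word_ball G steps n.
    a \<otimes>\<^bsub>G\<^esub> b = b \<otimes>\<^bsub>G\<^esub> a}) / (real (card (word_ball G steps n)))\<^sup>2"
  have "(\<lambda>m. (6 * real m + 5) / 2 ^ m) \<longlonglongrightarrow> 0"
    by real_asymp
  moreover have "filterlim (\<lambda>n::nat. n div 2) at_top at_top"
    by (rule filterlim_at_top_div_const_nat) simp
  ultimately have "(\<lambda>n. (6 * real (n div 2) + 5) / 2 ^ (n div 2)) \<longlonglongrightarrow> 0"
    by (rule filterlim_compose)
  then have "?r \<longlonglongrightarrow> 0"
    by (rule tendsto_sandwich[OF _ _ tendsto_const, rotated 2])
      (use commuting_ratio_le[OF assms] in auto)
  then have "(\<lambda>n. ereal (?r n)) \<longlonglongrightarrow> 0"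
    by (simp add: zero_ereal_def)
  then show ?thesis
    unfolding degree_of_commutativity_def by (intro lim_imp_Limsup) auto
qed

end

theorem theorem2:
  fixes F :: "('a, 'b) monoid_scheme"
  assumes "group F" and "finite (carrier F)" and "carrier F \<noteq> {\<one>\<^bsub>F\<^esub>}"
  defines "G \<equiv> wreath_product F integer_group"
  shows "\<exists>S. S \<subseteq> carrier G \<and> finite S \<and> generate G S = carrier G \<and>
           degree_of_commutativity G S = 0"
proof -
  interpret lamplighter F G
    by (simp_all add: lamplighter_def assms(1) G_def)
  have "finite steps"
    using assms(2) by (simp add: steps_def)
  then show ?thesis
    using steps_subset generate_steps degree_of_commutativity_steps[OF assms(2,3)] by blast
qed

end
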